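(* Let $A$ be a PAJ generated by a set $X$ of primitive axes and let $a\in X$. Then either $A_0(a)^2\subseteq A_0(a)$, or else $a$ is of type $-1$, there exists a primitive axis $b\in A$ of type $2$ with $ab\neq0$, and $a$ is in the radical of any Frobenius form on $A$.
   Context: Algebras are not necessarily associative, commutative or unital. $\mathbb F$ is a field of characteristic $\ne 2$ and $A$ is an $\mathbb F$-algebra. For an idempotent $a\in A$ put $A_0(a)=\{y\in A: ay=ya=0\}$ and $A_{\lambda,\delta}(a)=\{y\in A: ay=\lambda y,\ ya=\delta y\}$. For $\lambda,\delta\in\mathbb F\setminus\{0,1\}$, a primitive axis of type $(\lambda,\delta)$ is a nonzero idempotent $a\in A$ with $\{y:ay=y\}=\mathbb Fa=\{y:ya=y\}$, such that $A=\mathbb Fa\oplus A_0(a)\oplus A_{\lambda,\delta}(a)$ and this is a $\mathbb Z_2$-grading with even part $\mathbb Fa\oplus A_0(a)$ and odd part $A_{\lambda,\delta}(a)$. If $\lambda=\delta$ the type is called commutative and is also denoted $\lambda$; if $\lambda\neq\delta$ it is called noncommutative, and then $\lambda+\delta=1$ (a known fact, taken as a convention). Each primitive axis is regarded as carrying exactly one type (if $A_{\lambda,\delta}(a)=0$, a fixed choice is made). A PAJ is an algebra generated by a set of primitive axes (possibly of different types). A Frobenius form on $A$ is a nonzero bilinear form $(\cdot,\cdot):A\times A\to\mathbb F$ with $(x,yz)=(xy,z)$ for all $x,y,z\in A$. Its radical is $\{u\in A:(u,v)=0\ \text{for all } v\in A\}$. $A_0(a)^2$ denotes the set (or span) of products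 of two elements of $A_0(a)$. *)

theory Defs
  imports Complex_Main
begin

text \<open>The algebra is the whole type; the product is bilinear and nothing else is assumed of it.\<close>

locale nonassoc_algebra = vector_space scale
  for scale :: "'f::field \<Rightarrow> 'a::ab_group_add \<Rightarrow> 'a"  (infixr \<open>*s\<close> 75) +
  fixes mult :: "'a \<Rightarrow> 'a \<Rightarrow> 'a"  (infixl \<open>\<bullet>\<close> 70)
  assumes mult_add_left: "(x + y) \<bullet> z = x \<bullet> z + y \<bullet> z"
    and mult_add_right: "x \<bullet> (y + z) = x \<bullet> y + x \<bullet> z"
    and mult_scale_left: "(c *s x) \<bullet> y = c *s (x \<bullet> y)"
    and mult_scale_right: "x \<bullet> (c *s y) = c *s (x \<bullet> y)"
begin

definition generated_subalgebra :: "'a set \<Rightarrow> 'a set" where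
  "generated_subalgebra X =
     (\<lambda>S. subspace S \<and> (\<forall>x\<in>S. \<forall>y\<in>S. x \<bullet> y \<in> S)) hull X"

definition zero_space :: "'a \<Rightarrow> 'a set" where
  "zero_space a = {y. a \<bullet> y = 0 \<and> y \<bullet> a = 0}"

definition eigenspace :: "'a \<Rightarrow> 'f \<Rightarrow> 'f \<Rightarrow> 'a set" where
  "eigenspace a l d = {y. a \<bullet> y = l *s y \<and> y \<bullet> a = d *s y}"

definition even_part :: "'a \<Rightarrow> 'a set" where
  "even_part a = {u + v |u v. u \<in> span {a} \<and> v \<in> zero_space a}"

text \<open>The last condition is the convention that in a noncommutative type \<open>(l, d)\<close>, that is one with
  \<open>l \<noteq> d\<close>, one has \<open>l + d = 1\<close>.\<close>

definition is_type :: "'f \<Rightarrow> 'f \<Rightarrow> bool" where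
  "is_type l d \<longleftrightarrow> l \<notin> {0, 1} \<and> d \<notin> {0, 1} \<and> (l \<noteq> d \<longrightarrow> l + d = 1)"

definition primitive_axis_of_type :: "'a \<Rightarrow> 'f \<Rightarrow> 'f \<Rightarrow> bool" where
  "primitive_axis_of_type a l d \<longleftrightarrow>
     is_type l d \<and>
     a \<noteq> 0 \<and> a \<bullet> a = a \<and>
     {y. a \<bullet> y = y} = span {a} \<and> {y. y \<bullet> a = y} = span {a} \<and>
     (\<forall>y. \<exists>!(u, v, w). u \<in> span {a} \<and> v \<in> zero_space a \<and> w \<in> eigenspace a l d \<and> y = u + v + w) \<and>
     (\<forall>x\<in>even_part a. \<forall>y\<in>even_part a. x \<bullet> y \<in> even_part a) \<and>
     (\<forall>x\<in>even_part a. \<forall>y\<in>eigenspace a l d. x \<bullet> y \<in> eigenspace a l d) \<and>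
     (\<forall>x\<in>eigenspace a l d. \<forall>y\<in>even_part a. x \<bullet> y \<in> eigenspace a l d) \<and>
     (\<forall>x\<in>eigenspace a l d. \<forall>y\<in>eigenspace a l d. x \<bullet> y \<in> even_part a)"

definition primitive_axis :: "'a \<Rightarrow> bool" where
  "primitive_axis a \<longleftrightarrow> (\<exists>l d. primitive_axis_of_type a l d)"

text \<open>A fixed choice of one type for every primitive axis. When \<open>eigenspace a l d = {0}\<close>, the axis \<open>a\<close>
  satisfies \<open>primitive_axis_of_type a\<close> for every type, so that predicate does not determine the type.\<close>

definition type_assignment :: "('a \<Rightarrow> 'f \<times> 'f) \<Rightarrow> bool" where
  "type_assignment ty \<longleftrightarrow>
     (\<forall>a. primitive_axis a \<longrightarrow> primitive_axis_of_type a (fst (ty a)) (snd (ty a)))"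

definition PAJ_generated_by :: "'a set \<Rightarrow> bool" where
  "PAJ_generated_by X \<longleftrightarrow> (\<forall>x\<in>X. primitive_axis x) \<and> generated_subalgebra X = UNIV"

definition frobenius_form :: "('a \<Rightarrow> 'a \<Rightarrow> 'f) \<Rightarrow> bool" where
  "frobenius_form B \<longleftrightarrow>
     (\<forall>x. Vector_Spaces.linear (*s) (*) (\<lambda>y. B x y)) \<and>
     (\<forall>y. Vector_Spaces.linear (*s) (*) (\<lambda>x. B x y)) \<and>
     (\<exists>x y. B x y \<noteq> 0) \<and>
     (\<forall>x y z. B x (y \<bullet> z) = B (x \<bullet> y) z)"

definition form_radical :: "('a \<Rightarrow> 'a \<Rightarrow> 'f) \<Rightarrow> 'a set" where
  "form_radical B = {u. \<forall>v. B u v = 0}"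

end

end

theory Submission
  imports Defs
begin

text \<open>
  Write \<open>phi a y\<close> for the coefficient of \<open>a\<close> in \<open>y\<close>. Since \<open>a y\<close> is a combination of \<open>a\<close>, \<open>y\<close> and the
  reflected element \<open>tau a y\<close>, a PAJ is spanned by its primitive axes. For two axes \<open>a\<close>, \<open>b\<close> of types
  \<open>l\<close>, \<open>m\<close>, comparing coefficients in a few identities shows that \<open>phi a b\<close> and \<open>phi b a\<close> agree, except
  when \<open>l + m = 1\<close> and \<open>phi a b = (1 + m) / 2\<close>, \<open>phi b a = (1 + l) / 2\<close>. Hence
  \<open>w a * phi a b = w b * phi b a\<close> for the weight \<open>w = 1 + l\<close> on commutative types and \<open>w = 1\<close> on
  noncommutative ones. As in the case of a Frobenius form, this symmetry makes multiplication by an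
  axis self-adjoint, so that \<open>w a * phi a (y c) = 0\<close> whenever \<open>y\<close> lies in the zero space of \<open>a\<close>. The
  weight vanishes only for type \<open>-1\<close>, and there it may be replaced by \<open>1\<close> unless some axis \<open>b\<close> of
  type \<open>2\<close> satisfies \<open>phi a b = 3 / 2 \<noteq> 0 = phi b a\<close>. In that case \<open>B(a, b) = phi a b * B(a, a)
  = phi b a * B(b, b)\<close> forces \<open>B(a, a) = 0\<close> for every Frobenius form.
\<close>

section \<open>The decomposition defined by an axis and its transport by automorphisms\<close>

context nonassoc_algebra
begin

lemma mult_zero_left [simp]: "0 \<bullet> x = 0"
  using mult_scale_left[of 0 0 x] by simp

lemma mult_zero_right [simp]: "x \<bullet> 0 = 0"
  using mult_scale_right[of x 0 0] by simp

lemma mult_diff_left: "(x - y) \<bullet> z = x \<bullet> z - y \<bullet> z"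
  using mult_add_left[of "x - y" y z] by simp

lemma mult_diff_right: "x \<bullet> (y - z) = x \<bullet> y - x \<bullet> z"
  using mult_add_right[of x "y - z" z] by simp

lemma scale_two: "2 *s x = x + x"
  using scale_left_distrib[of 1 1 x] by simp

lemmas mult_distribs = mult_add_left mult_add_right mult_diff_left mult_diff_right
  mult_scale_left mult_scale_right

lemma zero_spaceD: "y \<in> zero_space a \<Longrightarrow> a \<bullet> y = 0" "y \<in> zero_space a \<Longrightarrow> y \<bullet> a = 0"
  by (auto simp: zero_space_def)

lemma eigenspaceD: "y \<in> eigenspace a l d \<Longrightarrow> a \<bullet> y = l *s y" "y \<in> eigenspace a l d \<Longrightarrow> y \<bullet> a = d *s y"
  by (auto simp: eigenspace_def)

lemma zero_space_add: "x \<in> zero_space a \<Longrightarrow> y \<in> zero_space a \<Longrightarrow> x + y \<in> zero_space a"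
  by (auto simp: zero_space_def mult_distribs)

lemma zero_space_scale: "x \<in> zero_space a \<Longrightarrow> c *s x \<in> zero_space a"
  by (auto simp: zero_space_def mult_distribs)

lemma zero_space_diff: "x \<in> zero_space a \<Longrightarrow> y \<in> zero_space a \<Longrightarrow> x - y \<in> zero_space a"
  by (auto simp: zero_space_def mult_distribs)

lemma zero_in_zero_space [simp]: "0 \<in> zero_space a"
  by (auto simp: zero_space_def)

lemma eigenspace_add: "x \<in> eigenspace a l d \<Longrightarrow> y \<in> eigenspace a l d \<Longrightarrow> x + y \<in> eigenspace a l d"
  by (auto simp: eigenspace_def mult_distribs scale_right_distrib)

lemma eigenspace_scale: "x \<in> eigenspace a l d \<Longrightarrow> c *s x \<in> eigenspace a l d"
  by (auto simp: eigenspace_def mult_distribs mult.commute)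

lemma eigenspace_diff: "x \<in> eigenspace a l d \<Longrightarrow> y \<in> eigenspace a l d \<Longrightarrow> x - y \<in> eigenspace a l d"
  by (auto simp: eigenspace_def mult_distribs scale_right_diff_distrib)

lemma zero_in_eigenspace [simp]: "0 \<in> eigenspace a l d"
  by (auto simp: eigenspace_def)

lemma even_part_iff: "x \<in> even_part a \<longleftrightarrow> (\<exists>c v. v \<in> zero_space a \<and> x = c *s a + v)"
  by (auto simp: even_part_def span_singleton)

lemma even_part_add: "x \<in> even_part a \<Longrightarrow> y \<in> even_part a \<Longrightarrow> x + y \<in> even_part a"
proof -
  assume "x \<in> even_part a" "y \<in> even_part a"
  then obtain c v c' v' where "v \<in> zero_space a" "x = c *s a + v" "v' \<in> zero_space a" "y = c' *s a + v'"
    by (auto simp: even_part_iff)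
  then have "v + v' \<in> zero_space a" "x + y = (c + c') *s a + (v + v')"
    by (auto simp: zero_space_add algebra_simps)
  then show ?thesis
    unfolding even_part_iff by blast
qed

text \<open>Multiplying the sum by \<open>a\<close> on the left once and twice gives two relations
  whose difference is \<open>(l * (l - 1)) *s w = 0\<close>. Since \<open>l\<close> is neither 0 nor
  1, \<open>w\<close> vanishes, and the other two terms follow.\<close>

lemma decomposition_zero:
  assumes "a \<bullet> a = a" "a \<noteq> 0" "l \<notin> {0, 1}" "v \<in> zero_space a" "w \<in> eigenspace a l d"
    and sum: "c *s a + v + w = 0"
  shows "c = 0" "v = 0" "w = 0"
proof -
  have 1: "c *s a + l *s w = 0"
    using arg_cong[OF sum, of "\<lambda>x. a \<bullet> x"] assms(1)
      zero_spaceD(1)[OF assms(4)] eigenspaceD(1)[OF assms(5)] by (simp add: mult_distribs)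
  have 2: "c *s a + (l * l) *s w = 0"
    using arg_cong[OF 1, of "\<lambda>x. a \<bullet> x"] assms(1)
      eigenspaceD(1)[OF assms(5)] by (simp add: mult_distribs)
  have "(l * (l - 1)) *s w = (c *s a + (l * l) *s w) - (c *s a + l *s w)"
    by (simp add: algebra_simps)
  then have "(l * (l - 1)) *s w = 0"
    using 1 2 by simp
  then show w: "w = 0"
    using assms(3) by simp
  then show "c = 0"
    using 1 assms(2) by simp
  then show "v = 0"
    using sum w by simp
qed

lemma decomposition_unique:
  assumes "a \<bullet> a = a" "a \<noteq> 0" "l \<notin> {0, 1}" "v \<in> zero_space a" "w \<in> eigenspace a l d"
    "v' \<in> zero_space a" "w' \<in> eigenspace a l d" and eq: "c *s a + v + w = c' *s a + v' + w'"
  shows "c = c'" "v = v'" "w = w'"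
proof -
  have "(c - c') *s a + (v - v') + (w - w') = 0"
    using eq by (simp add: algebra_simps)
  from decomposition_zero[OF assms(1-3) zero_space_diff[OF assms(4,6)] eigenspace_diff[OF assms(5,7)] this]
  show "c = c'" "v = v'" "w = w'" by auto
qed

text \<open>A form suited to transport along automorphisms: a plain existence statement stands for
  the unique decomposition, uniqueness being supplied by
  \<open>decomposition_unique\<close>.\<close>

lemma primitive_axis_of_type_iff:
  "primitive_axis_of_type a l d \<longleftrightarrow>
     is_type l d \<and> a \<noteq> 0 \<and> a \<bullet> a = a \<and>
     (\<forall>y. a \<bullet> y = y \<longrightarrow> y \<in> span {a}) \<and> (\<forall>y. y \<bullet> a = y \<longrightarrow> y \<in> span {a}) \<and>
     (\<forall>y. \<exists>c v w. v \<in> zero_space a \<and> w \<in> eigenspace a l d \<and> y = c *s a + v + w) \<and>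
     (\<forall>x\<in>even_part a. \<forall>y\<in>even_part a. x \<bullet> y \<in> even_part a) \<and>
     (\<forall>x\<in>even_part a. \<forall>y\<in>eigenspace a l d. x \<bullet> y \<in> eigenspace a l d) \<and>
     (\<forall>x\<in>eigenspace a l d. \<forall>y\<in>even_part a. x \<bullet> y \<in> eigenspace a l d) \<and>
     (\<forall>x\<in>eigenspace a l d. \<forall>y\<in>eigenspace a l d. x \<bullet> y \<in> even_part a)"
    (is "?L \<longleftrightarrow> ?R")
proof
  assume L: ?L
  have "\<forall>y. \<exists>c v w. v \<in> zero_space a \<and> w \<in> eigenspace a l d \<and> y = c *s a + v + w"
  proof
    fix y
    have "\<exists>!(u, v, w). u \<in> span {a} \<and> v \<in> zero_space a \<and> w \<in> eigenspace a l d \<and> y = u + v + w"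
      using L unfolding primitive_axis_of_type_def by - (elim conjE, erule allE, assumption)
    then obtain u v w where "u \<in> span {a}" "v \<in> zero_space a" "w \<in> eigenspace a l d" "y = u + v + w"
      by (elim ex1E) (simp only: split_beta, blast)
    then show "\<exists>c v w. v \<in> zero_space a \<and> w \<in> eigenspace a l d \<and> y = c *s a + v + w"
      by (auto simp: span_singleton)
  qed
  moreover have "\<forall>y. a \<bullet> y = y \<longrightarrow> y \<in> span {a}" "\<forall>y. y \<bullet> a = y \<longrightarrow> y \<in> span {a}"
    using L unfolding primitive_axis_of_type_def set_eq_iff mem_Collect_eq by simp_all
  ultimately show ?R
    using L unfolding primitive_axis_of_type_def by - (elim conjE, intro conjI; assumption)
next
  assume R: ?R
  have idem: "a \<bullet> a = a" and nz: "a \<noteq> 0" and l: "l \<notin> {0, 1}"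
    and one: "\<And>y. a \<bullet> y = y \<Longrightarrow> y \<in> span {a}" "\<And>y. y \<bullet> a = y \<Longrightarrow> y \<in> span {a}"
    and ex: "\<And>y. \<exists>c v w. v \<in> zero_space a \<and> w \<in> eigenspace a l d \<and> y = c *s a + v + w"
    using R unfolding is_type_def by blast+
  have "\<forall>y. \<exists>!(u, v, w). u \<in> span {a} \<and> v \<in> zero_space a \<and> w \<in> eigenspace a l d \<and> y = u + v + w"
  proof
    fix y
    obtain c v w where "v \<in> zero_space a" "w \<in> eigenspace a l d" "y = c *s a + v + w"
      using ex by blast
    then show "\<exists>!(u, v, w). u \<in> span {a} \<and> v \<in> zero_space a \<and> w \<in> eigenspace a l d \<and> y = u + v + w"
      by (intro ex1I[of _ "(c *s a, v, w)"])
        (auto simp: span_singleton dest: decomposition_unique[OF idem nz l, of v w d])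
  qed
  moreover have "{y. a \<bullet> y = y} = span {a}" "{y. y \<bullet> a = y} = span {a}"
    using one idem by (auto simp: span_singleton mult_distribs)
  ultimately show ?L
    using R unfolding primitive_axis_of_type_def by - (elim conjE, intro conjI; assumption)
qed

text \<open>Since \<open>f\<close> is its own inverse, membership in each space attached to
  \<open>f a\<close> is tested by applying \<open>f\<close> and asking about \<open>a\<close>; every
  clause then transfers.\<close>

lemma primitive_axis_of_type_involution:
  assumes add: "\<And>x y. f (x + y) = f x + f y" and scale: "\<And>c x. f (c *s x) = c *s f x"
    and mult: "\<And>x y. f (x \<bullet> y) = f x \<bullet> f y" and invol: "\<And>x. f (f x) = x"
    and a: "primitive_axis_of_type a l d"
  shows "primitive_axis_of_type (f a) l d"
proof -
  have eq: "f x = y \<longleftrightarrow> x = f y" for x y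
    using invol by metis
  have f0: "f 0 = 0"
    using scale[of 0 0] by simp
  have zero: "x \<in> zero_space (f a) \<longleftrightarrow> f x \<in> zero_space a" for x
    unfolding zero_space_def mem_Collect_eq by (metis mult invol f0)
  have eig: "x \<in> eigenspace (f a) l d \<longleftrightarrow> f x \<in> eigenspace a l d" for x
    unfolding eigenspace_def mem_Collect_eq by (metis mult invol scale)
  have span: "x \<in> span {f a} \<longleftrightarrow> f x \<in> span {a}" for x
    unfolding span_singleton by (auto simp: image_iff scale eq)
  have even: "x \<in> even_part (f a) \<longleftrightarrow> f x \<in> even_part a" for x
    unfolding even_part_iff zero by (metis add scale invol)
  have ty: "is_type l d" "a \<noteq> 0" "a \<bullet> a = a"
    and left: "a \<bullet> y = y \<Longrightarrow> y \<in> span {a}" and right: "y \<bullet> a = y \<Longrightarrow> y \<in> span {a}"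
    and ex: "\<exists>c v w. v \<in> zero_space a \<and> w \<in> eigenspace a l d \<and> y = c *s a + v + w"
    and ee: "x \<in> even_part a \<Longrightarrow> y \<in> even_part a \<Longrightarrow> x \<bullet> y \<in> even_part a"
    and eo: "x \<in> even_part a \<Longrightarrow> y \<in> eigenspace a l d \<Longrightarrow> x \<bullet> y \<in> eigenspace a l d"
    and oe: "x \<in> eigenspace a l d \<Longrightarrow> y \<in> even_part a \<Longrightarrow> x \<bullet> y \<in> eigenspace a l d"
    and oo: "x \<in> eigenspace a l d \<Longrightarrow> y \<in> eigenspace a l d \<Longrightarrow> x \<bullet> y \<in> even_part a" for x y
    using a unfolding primitive_axis_of_type_iff by blast+
  have "\<exists>c v w. f v \<in> zero_space a \<and> f w \<in> eigenspace a l d \<and> y = c *s f a + v + w" for y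
    using ex[of "f y"] by (metis add scale invol)
  moreover have "y \<in> span {f a}" if "f a \<bullet> y = y" for y
    using that left[of "f y"] unfolding span by (metis mult invol)
  moreover have "y \<in> span {f a}" if "y \<bullet> f a = y" for y
    using that right[of "f y"] unfolding span by (metis mult invol)
  moreover have "f a \<bullet> f a = f a" "f a \<noteq> 0"
    using ty(2,3) mult eq f0 by metis+
  ultimately show ?thesis
    unfolding primitive_axis_of_type_iff Ball_def zero eig even mult
    using ty(1) ee eo oe oo by blast
qed

text \<open>The product \<open>a \<bullet> w\<close> is computed componentwise and as
  \<open>l' *s w\<close>. As \<open>l'\<close> is neither 0 nor 1, only the odd component of
  \<open>w\<close> survives, and its eigenvalues are \<open>l\<close> and \<open>d\<close>. Hence a
  nonzero odd part determines the type.\<close>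

lemma eigenspace_type_unique:
  assumes a: "primitive_axis_of_type a l d" and w: "w \<in> eigenspace a l' d'" "w \<noteq> 0" and l': "l' \<notin> {0, 1}"
  shows "l' = l" "d' = d"
proof -
  have ax: "a \<bullet> a = a" "a \<noteq> 0" "l \<notin> {0, 1}"
    using a unfolding primitive_axis_of_type_iff is_type_def by blast+
  obtain c v w' where v: "v \<in> zero_space a" and w': "w' \<in> eigenspace a l d" and eq: "w = c *s a + v + w'"
    using a unfolding primitive_axis_of_type_iff by blast
  have "a \<bullet> w = c *s a + 0 + l *s w'"
    using eq v w' ax by (simp add: mult_distribs zero_spaceD eigenspaceD)
  moreover have "a \<bullet> w = (l' * c) *s a + l' *s v + l' *s w'"
    using eigenspaceD(1)[OF w(1)] eq by (simp add: algebra_simps)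
  ultimately have "c = l' * c" "0 = l' *s v" "l *s w' = l' *s w'"
    using decomposition_unique[OF ax, of 0 "l *s w'" d "l' *s v" "l' *s w'" c "l' * c"] v w'
    by (auto simp: zero_space_scale eigenspace_scale)
  then have "c = 0" "v = 0" and ll: "w' = 0 \<or> l = l'"
    using l' by auto
  then have ww: "w = w'"
    using eq by simp
  then show "l' = l"
    using ll w by auto
  have "d' *s w = d *s w"
    using eigenspaceD(2)[OF w(1)] eigenspaceD(2)[OF w'] ww by metis
  then show "d' = d"
    using w(2) by (metis scale_cancel_right)
qed

end

section \<open>Components, multiplication formulas and reflections for axes of assigned type\<close>

locale typed_algebra = nonassoc_algebra scale mult
  for scale :: "'f::field \<Rightarrow> 'a::ab_group_add \<Rightarrow> 'a"  (infixr \<open>*s\<close> 75)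
    and mult :: "'a \<Rightarrow> 'a \<Rightarrow> 'a"  (infixl \<open>\<bullet>\<close> 70) +
  fixes ty :: "'a \<Rightarrow> 'f \<times> 'f"
  assumes two_nonzero [simp]: "(2::'f) \<noteq> 0"
    and types: "type_assignment ty"
begin

abbreviation lt :: "'a \<Rightarrow> 'f" where "lt a \<equiv> fst (ty a)"
abbreviation rt :: "'a \<Rightarrow> 'f" where "rt a \<equiv> snd (ty a)"

abbreviation odd_part :: "'a \<Rightarrow> 'a set" where "odd_part a \<equiv> eigenspace a (lt a) (rt a)"

definition phi :: "'a \<Rightarrow> 'a \<Rightarrow> 'f" where
  "phi a y = (THE c. \<exists>v w. v \<in> zero_space a \<and> w \<in> odd_part a \<and> y = c *s a + v + w)"

definition odd_comp :: "'a \<Rightarrow> 'a \<Rightarrow> 'a" where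
  "odd_comp a y = (THE w. \<exists>c v. v \<in> zero_space a \<and> w \<in> odd_part a \<and> y = c *s a + v + w)"

definition zero_comp :: "'a \<Rightarrow> 'a \<Rightarrow> 'a" where
  "zero_comp a y = y - phi a y *s a - odd_comp a y"

text \<open>The Miyamoto involution of an axis: the identity on the even part and minus the identity
  on the odd part.\<close>

definition tau :: "'a \<Rightarrow> 'a \<Rightarrow> 'a" where
  "tau a y = y - 2 *s odd_comp a y"

lemma axis_type: "primitive_axis a \<Longrightarrow> primitive_axis_of_type a (lt a) (rt a)"
  using types by (auto simp: type_assignment_def)

lemma axisD:
  assumes "primitive_axis a"
  shows "a \<bullet> a = a" "a \<noteq> 0" "lt a \<notin> {0, 1}" "rt a \<notin> {0, 1}" "lt a \<noteq> rt a \<Longrightarrow> lt a + rt a = 1"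
    "x \<in> even_part a \<Longrightarrow> y \<in> even_part a \<Longrightarrow> x \<bullet> y \<in> even_part a"
    "x \<in> even_part a \<Longrightarrow> y \<in> odd_part a \<Longrightarrow> x \<bullet> y \<in> odd_part a"
    "x \<in> odd_part a \<Longrightarrow> y \<in> even_part a \<Longrightarrow> x \<bullet> y \<in> odd_part a"
    "x \<in> odd_part a \<Longrightarrow> y \<in> odd_part a \<Longrightarrow> x \<bullet> y \<in> even_part a"
  using axis_type[OF assms] unfolding primitive_axis_of_type_iff is_type_def by blast+

lemma decomposition_eqs:
  assumes a: "primitive_axis a" and vw: "v \<in> zero_space a" "w \<in> odd_part a" and y: "y = c *s a + v + w"
  shows "phi a y = c" "zero_comp a y = v" "odd_comp a y = w"
proof -
  note u = decomposition_unique[OF axisD(1-3)[OF a] vw]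
  show 1: "phi a y = c"
    unfolding phi_def using u(1) vw y by (intro the_equality) metis+
  show 2: "odd_comp a y = w"
    unfolding odd_comp_def using u(3) vw y by (intro the_equality) metis+
  show "zero_comp a y = v"
    unfolding zero_comp_def 1 2 using y by simp
qed

context
  fixes a assumes a: "primitive_axis a"
begin

lemma decomposition:
  "y = phi a y *s a + zero_comp a y + odd_comp a y" "zero_comp a y \<in> zero_space a" "odd_comp a y \<in> odd_part a"
proof -
  obtain c v w where "v \<in> zero_space a" "w \<in> odd_part a" "y = c *s a + v + w"
    using axis_type[OF a] unfolding primitive_axis_of_type_iff by blast
  with decomposition_eqs[OF a this]
  show "y = phi a y *s a + zero_comp a y + odd_comp a y" "zero_comp a y \<in> zero_space a" "odd_comp a y \<in> odd_part a" by auto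
qed

lemma decomposition_add:
  "phi a (x + y) = phi a x + phi a y" "zero_comp a (x + y) = zero_comp a x + zero_comp a y" "odd_comp a (x + y) = odd_comp a x + odd_comp a y"
proof -
  have "x + y = (phi a x + phi a y) *s a + (zero_comp a x + zero_comp a y) + (odd_comp a x + odd_comp a y)"
    using arg_cong2[OF decomposition(1)[of x] decomposition(1)[of y], of "(+)"] by (simp add: algebra_simps)
  from decomposition_eqs[OF a zero_space_add eigenspace_add this, OF decomposition(2,2,3,3)]
  show "phi a (x + y) = phi a x + phi a y" "zero_comp a (x + y) = zero_comp a x + zero_comp a y"
    "odd_comp a (x + y) = odd_comp a x + odd_comp a y" by simp_all
qed

lemma decomposition_scale:
  "phi a (c *s x) = c * phi a x" "zero_comp a (c *s x) = c *s zero_comp a x" "odd_comp a (c *s x) = c *s odd_comp a x"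
proof -
  have "c *s x = (c * phi a x) *s a + c *s zero_comp a x + c *s odd_comp a x"
    using arg_cong[OF decomposition(1)[of x], of "\<lambda>x. c *s x"] by (simp add: algebra_simps)
  from decomposition_eqs[OF a zero_space_scale eigenspace_scale this, OF decomposition(2,3)]
  show "phi a (c *s x) = c * phi a x" "zero_comp a (c *s x) = c *s zero_comp a x" "odd_comp a (c *s x) = c *s odd_comp a x"
    by simp_all
qed

lemma decomposition_diff:
  "phi a (x - y) = phi a x - phi a y" "zero_comp a (x - y) = zero_comp a x - zero_comp a y" "odd_comp a (x - y) = odd_comp a x - odd_comp a y"
  using decomposition_add[of "x - y" y] by auto

lemmas decomposition_linear = decomposition_add decomposition_scale decomposition_diff

lemma decomposition_self: "phi a a = 1" "zero_comp a a = 0" "odd_comp a a = 0"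
  using decomposition_eqs[OF a, of 0 0 a 1] by auto

lemma decomposition_zero_space:
  assumes "x \<in> zero_space a" shows "phi a x = 0" "zero_comp a x = x" "odd_comp a x = 0"
  using decomposition_eqs[OF a assms, of 0 x 0] by auto

lemma decomposition_odd_part:
  assumes "x \<in> odd_part a" shows "phi a x = 0" "zero_comp a x = 0" "odd_comp a x = x"
  using decomposition_eqs[OF a _ assms, of 0 x 0] by auto

lemma even_part_iff_odd: "x \<in> even_part a \<longleftrightarrow> odd_comp a x = 0"
  using decomposition[of x] decomposition_eqs(3)[OF a, of _ 0 x] zero_in_eigenspace
  unfolding even_part_iff by (metis add.right_neutral)

lemma left_mult: "a \<bullet> y = phi a y *s a + lt a *s odd_comp a y"
  using arg_cong[OF decomposition(1)[of y], of "\<lambda>x. a \<bullet> x"]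
  by (simp add: mult_distribs zero_spaceD[OF decomposition(2)] eigenspaceD[OF decomposition(3)] axisD(1)[OF a])

lemma right_mult: "y \<bullet> a = phi a y *s a + rt a *s odd_comp a y"
  using arg_cong[OF decomposition(1)[of y], of "\<lambda>x. x \<bullet> a"]
  by (simp add: mult_distribs zero_spaceD[OF decomposition(2)] eigenspaceD[OF decomposition(3)] axisD(1)[OF a])

lemma axis_commutes: "lt a = rt a \<Longrightarrow> a \<bullet> y = y \<bullet> a"
  by (simp add: left_mult right_mult)

text \<open>Together with \<open>left_mult\<close> and \<open>right_mult\<close>, this turns a
  product of two axes into a combination of axes.\<close>

lemma odd_tau: "odd_comp a y = (1/2) *s (y - tau a y)"
  by (simp add: tau_def)

lemma tau_linear:
  "tau a (x + y) = tau a x + tau a y" "tau a (c *s x) = c *s tau a x" "tau a (x - y) = tau a x - tau a y"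
  by (auto simp: tau_def decomposition_linear algebra_simps)

lemma tau_involution [simp]: "tau a (tau a x) = x"
  by (simp add: tau_def decomposition_linear decomposition_odd_part decomposition algebra_simps
      flip: scale_left_distrib)

lemma tau_even: "odd_comp a x = 0 \<Longrightarrow> tau a x = x"
  by (simp add: tau_def)

text \<open>By the grading, only the two mixed products of even and odd components are odd.\<close>

lemma odd_mult: "odd_comp a (x \<bullet> y) = (x - odd_comp a x) \<bullet> odd_comp a y + odd_comp a x \<bullet> (y - odd_comp a y)"
proof -
  define x0 x1 y0 y1 where d: "x0 = x - odd_comp a x" "x1 = odd_comp a x" "y0 = y - odd_comp a y" "y1 = odd_comp a y"
  have x: "x0 \<in> even_part a" "x1 \<in> odd_part a" and y: "y0 \<in> even_part a" "y1 \<in> odd_part a"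
    by (auto simp: d even_part_iff_odd decomposition_linear decomposition_odd_part decomposition)
  have 1: "x0 \<bullet> y0 + x1 \<bullet> y1 \<in> even_part a" "x0 \<bullet> y1 + x1 \<bullet> y0 \<in> odd_part a"
    by (intro even_part_add eigenspace_add axisD(6-9)[OF a] x y)+
  have "x = x0 + x1" "y = y0 + y1"
    by (auto simp: d)
  then have "x \<bullet> y = (x0 \<bullet> y0 + x1 \<bullet> y1) + (x0 \<bullet> y1 + x1 \<bullet> y0)"
    by (simp add: mult_distribs algebra_simps)
  then have "odd_comp a (x \<bullet> y) = odd_comp a (x0 \<bullet> y0 + x1 \<bullet> y1) + odd_comp a (x0 \<bullet> y1 + x1 \<bullet> y0)"
    by (simp only: decomposition_add)
  also have "\<dots> = x0 \<bullet> y1 + x1 \<bullet> y0"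
    using even_part_iff_odd[THEN iffD1, OF 1(1)] decomposition_odd_part(3)[OF 1(2)] by simp
  finally show ?thesis
    by (simp add: d)
qed

lemma tau_mult: "tau a (x \<bullet> y) = tau a x \<bullet> tau a y"
proof -
  have "tau a z = z - odd_comp a z - odd_comp a z" for z
    by (simp add: tau_def scale_two)
  then show ?thesis
    by (simp add: odd_mult mult_distribs)
qed

lemma tau_axis_of_type: "primitive_axis_of_type b l d \<Longrightarrow> primitive_axis_of_type (tau a b) l d"
  by (rule primitive_axis_of_type_involution[OF tau_linear(1,2) tau_mult tau_involution])

lemma tau_axis: "primitive_axis b \<Longrightarrow> primitive_axis (tau a b)"
  unfolding primitive_axis_def using tau_axis_of_type by blast

text \<open>This is the odd component of the equation \<open>b \<bullet> b = b\<close>.\<close>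

lemma idempotent_odd:
  assumes "b \<bullet> b = b"
  shows "(b - odd_comp a b) \<bullet> odd_comp a b + odd_comp a b \<bullet> (b - odd_comp a b) = odd_comp a b"
  using odd_mult[of b b] assms by simp

end

section \<open>Coefficients of two axes with respect to each other\<close>

text \<open>Here \<open>b \<bullet> a = phi a b *s a\<close>. If the coefficient is zero, both
  products vanish. Otherwise \<open>a\<close> is an eigenvector of left multiplication by
  \<open>b\<close>, without zero component. A nonzero odd component would force
  \<open>phi a b = lt b\<close> and \<open>phi b a = 0\<close>, so that \<open>a\<close> would be
  odd and \<open>a = a \<bullet> a\<close> even. Thus \<open>a\<close> is an idempotent multiple of
  \<open>b\<close>.\<close>

lemma no_odd_component:
  assumes a: "primitive_axis a" and b: "primitive_axis b" and 0: "odd_comp a b = 0"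
  shows "a = b \<or> b \<in> zero_space a \<and> a \<in> zero_space b"
proof (cases "phi a b = 0")
  case True
  then have "a \<bullet> b = 0" "b \<bullet> a = 0"
    using 0 by (simp_all add: left_mult[OF a] right_mult[OF a])
  then show ?thesis
    by (simp add: zero_space_def)
next
  case False
  define p where "p = phi a b"
  have p: "p \<noteq> 0" using False by (simp add: p_def)
  have ba: "p *s a = phi b a *s b + lt b *s odd_comp b a"
    using right_mult[OF a, of b] left_mult[OF b, of a] 0 by (simp add: p_def)
  note lin = decomposition_linear[OF b] decomposition_self[OF b]
    decomposition_odd_part[OF b decomposition(3)[OF b]]
  have 1: "p * phi b a = phi b a" and "p *s zero_comp b a = 0" and 2: "p *s odd_comp b a = lt b *s odd_comp b a"
    using arg_cong[OF ba, of "phi b"] arg_cong[OF ba, of "zero_comp b"] arg_cong[OF ba, of "odd_comp b"]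
    by (simp_all add: lin)
  then have a_eq: "a = phi b a *s b + odd_comp b a"
    using p decomposition(1)[OF b, of a] by simp
  show ?thesis
  proof (cases "odd_comp b a = 0")
    case True
    then have eq: "a = phi b a *s b"
      using a_eq by simp
    have "a \<bullet> a = (phi b a * phi b a) *s b"
      by (subst (1 2) eq) (simp add: mult_distribs axisD(1)[OF b])
    then have "(phi b a * phi b a) *s b = phi b a *s b"
      using eq axisD(1)[OF a] by metis
    then have "phi b a = 0 \<or> phi b a = 1"
      using axisD(2)[OF b] by simp
    then show ?thesis
      using eq axisD(2)[OF a] by auto
  next
    case False
    then have "p = lt b" using 2 by simp
    then have "phi b a = 0" using 1 axisD(3)[OF b] by auto
    then have "a = odd_comp b a" using a_eq by simp
    then have "odd_comp b (a \<bullet> a) = 0"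
      by (metis odd_mult[OF b] diff_self mult_zero_left mult_zero_right add_0)
    then show ?thesis
      using False axisD(1)[OF a] by simp
  qed
qed

lemma product_zero_odd:
  assumes a: "primitive_axis a" and "a \<bullet> b = 0"
  shows "odd_comp a b = 0"
  using arg_cong[OF left_mult[OF a, of b], of "odd_comp a"] assms(2) axisD(3)[OF a] decomposition_zero_space[OF a, of 0]
  by (simp add: decomposition_linear[OF a] decomposition_self[OF a]
      decomposition_odd_part[OF a decomposition(3)[OF a]])

text \<open>Both \<open>a \<bullet> b\<close> and \<open>b \<bullet> a\<close> are expanded along
  each axis. Subtracting the two equations shows that \<open>b\<close> is noncommutative and that
  the odd components \<open>v\<close> and \<open>w\<close> are proportional, hence killed by
  \<open>phi a\<close> and \<open>phi b\<close>. Adding them, with eigenvalues summing to 1, gives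
  \<open>(2 * p) *s a + v = (2 * q) *s b + w\<close>; the two functionals then yield
  \<open>p = q * p = q\<close>.\<close>

lemma noncommutative_pair:
  assumes a: "primitive_axis a" and b: "primitive_axis b"
    and va: "odd_comp a b \<noteq> 0" and nc: "lt a \<noteq> rt a"
  shows "lt b \<noteq> rt b" "phi a b = phi b a"
proof -
  define v w p q where "v = odd_comp a b" and "w = odd_comp b a" and "p = phi a b" and "q = phi b a"
  note d = this
  have v: "v \<noteq> 0" using va d by simp
  have ab: "p *s a + lt a *s v = q *s b + rt b *s w" and ba: "p *s a + rt a *s v = q *s b + lt b *s w"
    using left_mult[OF a, of b] right_mult[OF a, of b] left_mult[OF b, of a] right_mult[OF b, of a]
    by (simp_all add: d)
  show ncb: "lt b \<noteq> rt b"
  proof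
    assume "lt b = rt b"
    then have "lt a *s v = rt a *s v"
      using ab ba by (metis add_left_cancel)
    then show False using nc v by simp
  qed
  have "(p *s a + lt a *s v) - (p *s a + rt a *s v) = (q *s b + rt b *s w) - (q *s b + lt b *s w)"
    using ab ba by simp
  then have dif: "(lt a - rt a) *s v = (rt b - lt b) *s w"
    by (simp add: algebra_simps)
  define k where "k = (lt a - rt a) / (rt b - lt b)"
  have k: "k \<noteq> 0" using nc ncb by (simp add: k_def)
  have w: "w = k *s v"
    using arg_cong[OF dif, of "\<lambda>x. (1 / (rt b - lt b)) *s x"] ncb by (simp add: k_def)
  then have v': "v = (1 / k) *s w" using k by simp
  have la: "lt a = 1 - rt a" "lt b = 1 - rt b"
    using axisD(5)[OF a nc] axisD(5)[OF b ncb] by (simp_all add: algebra_simps)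
  have "(p *s a + lt a *s v) + (p *s a + rt a *s v) = (q *s b + rt b *s w) + (q *s b + lt b *s w)"
    using ab ba by simp
  then have sum: "(2 * p) *s a + v = (2 * q) *s b + w"
    by (simp add: la algebra_simps flip: mult_2 scale_left_distrib)
  have pv: "phi a v = 0" "phi b w = 0"
    unfolding d by (rule decomposition_odd_part decomposition a b)+
  have "2 * p = 2 * q * p"
    using arg_cong[OF sum[unfolded w], of "phi a"] pv
    by (simp add: decomposition_linear[OF a] decomposition_self[OF a] flip: d)
  moreover have "2 * p * q = 2 * q"
    using arg_cong[OF sum[unfolded v'], of "phi b"] pv
    by (simp add: decomposition_linear[OF b] decomposition_self[OF b] flip: d)
  ultimately show "phi a b = phi b a"
    unfolding d(3,4)[symmetric] by auto
qed

text \<open>For \<open>b = p *s a + u + v\<close> the products amount to a multiplication table of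
  the span of \<open>a\<close>, \<open>u\<close>, \<open>v\<close>. That \<open>u\<close> and
  \<open>v\<close> commute comes from \<open>b\<close> commuting with \<open>v\<close>;
  \<open>u \<bullet> v\<close> is read off the odd part of \<open>b \<bullet> b = b\<close>, and
  \<open>u \<bullet> u\<close> off the rest of it.\<close>

lemma commutative_pair_products:
  assumes a: "primitive_axis a" and b: "primitive_axis b"
    and ca: "lt a = rt a" and cb: "lt b = rt b" and nz: "odd_comp a b \<noteq> 0"
  shows "lt a * (1 - 2 * lt b + 2 * phi a b) = 2 * phi b a * (1 - lt b)"
    and "zero_comp a b \<bullet> odd_comp a b = odd_comp a b \<bullet> zero_comp a b"
    and "zero_comp a b \<bullet> odd_comp a b = ((1 - 2 * phi a b * lt a) / 2) *s odd_comp a b"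
    and "lt a *s (odd_comp a b \<bullet> odd_comp a b) =
           (phi a b * (lt b + phi b a * (1 - lt b) - phi a b)) *s a + (phi b a * (1 - lt b)) *s zero_comp a b"
    and "zero_comp a b \<bullet> zero_comp a b =
           (phi a b - phi a b * phi a b) *s a + zero_comp a b - odd_comp a b \<bullet> odd_comp a b"
proof -
  define u v w p q l m where
    "u = zero_comp a b" and "v = odd_comp a b" and "w = odd_comp b a" and "p = phi a b" and "q = phi b a"
    and "l = lt a" and "m = lt b"
  note d = this
  have u: "u \<in> zero_space a" and v: "v \<in> odd_part a" and b_eq: "b = p *s a + u + v"
    unfolding d using decomposition[OF a] by auto
  have av: "a \<bullet> a = a" "a \<bullet> u = 0" "u \<bullet> a = 0" "a \<bullet> v = l *s v" "v \<bullet> a = l *s v"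
    using zero_spaceD[OF u] eigenspaceD[OF v] axisD(1)[OF a] by (auto simp: d(6) ca)
  have v0: "v \<noteq> 0" and l0: "l \<noteq> 0"
    using nz axisD(3)[OF a] by (auto simp: d)
  have "b \<bullet> v = v \<bullet> b"
    by (rule axis_commutes[OF b cb])
  then show uv: "zero_comp a b \<bullet> odd_comp a b = odd_comp a b \<bullet> zero_comp a b"
    unfolding d(1,2)[symmetric] by (simp add: b_eq mult_distribs av)
  define h where "h = (1 - 2 * p * l) / 2"
  have "(b - v) \<bullet> v + v \<bullet> (b - v) = v"
    unfolding d(2) by (rule idempotent_odd[OF a axisD(1)[OF b]])
  then have "(p * l) *s v + (p * l) *s v + (u \<bullet> v + u \<bullet> v) = v"
    unfolding b_eq using uv[folded d(1,2)] by (simp add: mult_distribs av algebra_simps)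
  then have "2 *s ((p * l) *s v) + 2 *s (u \<bullet> v) = v"
    by (simp only: scale_two)
  then have "2 *s (u \<bullet> v) = (1 - 2 * p * l) *s v"
    by (simp add: algebra_simps)
  from arg_cong[OF this, of "\<lambda>x. (1 / 2) *s x"] have uvh: "u \<bullet> v = h *s v"
    by (simp add: h_def)
  then show "zero_comp a b \<bullet> odd_comp a b = ((1 - 2 * phi a b * lt a) / 2) *s odd_comp a b"
    by (simp add: d h_def)
  have vuh: "v \<bullet> u = h *s v"
    using uv uvh d by simp
  have ba: "b \<bullet> a = p *s a + l *s v" "b \<bullet> a = q *s b + m *s w"
    using right_mult[OF a, of b] left_mult[OF b, of a] by (auto simp: d ca)
  have bw: "b \<bullet> w = m *s w"
    unfolding d by (rule eigenspaceD decomposition b)+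
  \<comment> \<open>That \<open>b (b a) = m (b a)\<close> up to a multiple of \<open>b\<close>
    determines \<open>v \<bullet> v\<close>, and the vanishing of its odd component is the first relation.\<close>
  have "b \<bullet> (b \<bullet> a) = m *s (b \<bullet> a) + (q * (1 - m)) *s b"
    unfolding ba(2) by (simp add: mult_distribs bw axisD(1)[OF b] algebra_simps)
  then have "b \<bullet> (p *s a + l *s v) = m *s (p *s a + l *s v) + (q * (1 - m)) *s b"
    unfolding ba(1) .
  then have E: "l *s (v \<bullet> v) = (p * (m + q * (1 - m) - p)) *s a + (q * (1 - m)) *s u
      + (m * l + q * (1 - m) - p * l - l * (p * l) - l * h) *s v"
    by (simp add: b_eq mult_distribs av uvh algebra_simps)
  have "odd_comp a (v \<bullet> v) = 0"
    using axisD(9)[OF a v v] even_part_iff_odd[OF a] by blast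
  then have "(m * l + q * (1 - m) - p * l - l * (p * l) - l * h) *s v = 0"
    using arg_cong[OF E, of "odd_comp a"] decomposition_zero_space(3)[OF a u] decomposition_odd_part(3)[OF a v]
    by (simp add: decomposition_linear[OF a] decomposition_self[OF a])
  then have c0: "m * l + q * (1 - m) - p * l - l * (p * l) - l * h = 0"
    using v0 by simp
  have h2: "2 * h = 1 - 2 * p * l"
    by (simp add: h_def)
  have "l * (1 - 2 * m + 2 * p) - 2 * q * (1 - m) = l * (1 - 2 * p * l - 2 * h)
      - 2 * (m * l + q * (1 - m) - p * l - l * (p * l) - l * h)"
    by (simp add: algebra_simps)
  then have "l * (1 - 2 * m + 2 * p) = 2 * q * (1 - m)"
    unfolding c0 h2 by simp
  then show "lt a * (1 - 2 * lt b + 2 * phi a b) = 2 * phi b a * (1 - lt b)"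
    by (simp add: d)
  show "lt a *s (odd_comp a b \<bullet> odd_comp a b) =
      (phi a b * (lt b + phi b a * (1 - lt b) - phi a b)) *s a + (phi b a * (1 - lt b)) *s zero_comp a b"
    using E unfolding c0 by (simp add: d)
  have "b \<bullet> b = (p * p) *s a + u \<bullet> u + v \<bullet> v + ((2 * (p * l)) *s v + 2 *s (h *s v))"
    unfolding b_eq by (simp add: mult_distribs av uvh vuh algebra_simps flip: mult_2 scale_left_distrib)
  also have "(2 * (p * l)) *s v + 2 *s (h *s v) = v"
    unfolding scale_scale h2 by (simp flip: scale_left_distrib)
  finally have "p *s a + u + v = (p * p) *s a + u \<bullet> u + v \<bullet> v + v"
    using axisD(1)[OF b] b_eq by simp
  then show "zero_comp a b \<bullet> zero_comp a b =
      (phi a b - phi a b * phi a b) *s a + zero_comp a b - odd_comp a b \<bullet> odd_comp a b"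
    unfolding d(1,2,4)[symmetric] by (simp add: algebra_simps)
qed

lemma commutative_pair_three_dim:
  assumes a: "primitive_axis a" and b: "primitive_axis b"
    and ca: "lt a = rt a" and cb: "lt b = rt b" and nz: "odd_comp a b \<noteq> 0" and u0: "zero_comp a b \<noteq> 0"
  shows "lt a * (1 - 2 * phi a b) = lt b * (1 - 2 * phi b a)"
proof -
  \<comment> \<open>The relation expresses that the odd component \<open>w\<close> of \<open>a\<close> with respect to \<open>b\<close> satisfies
    \<open>2 a w - 2 w w = w\<close>, which is the odd part of \<open>a a = a\<close> with respect to \<open>b\<close>.\<close>
  define u v w p q l m where
    "u = zero_comp a b" and "v = odd_comp a b" and "w = odd_comp b a" and "p = phi a b" and "q = phi b a"
    and "l = lt a" and "m = lt b"
  note d = this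
  have u: "u \<in> zero_space a" and v: "v \<in> odd_part a" and b_eq: "b = p *s a + u + v"
    unfolding d using decomposition[OF a] by auto
  have av: "a \<bullet> a = a" "a \<bullet> u = 0" "u \<bullet> a = 0" "a \<bullet> v = l *s v" "v \<bullet> a = l *s v"
    using zero_spaceD[OF u] eigenspaceD[OF v] axisD(1)[OF a] by (auto simp: d(6) ca)
  have v0: "v \<noteq> 0" and l0: "l \<noteq> 0" and m0: "m \<noteq> 0"
    using nz axisD(3)[OF a] axisD(3)[OF b] by (auto simp: d)
  note rel = commutative_pair_products[OF a b ca cb nz, folded d]
  define h S T where "h = (1 - 2 * p * l) / 2" and "S = p * (m + q * (1 - m) - p) / l" and "T = q * (1 - m) / l"
  have uv: "u \<bullet> v = h *s v" "v \<bullet> u = h *s v"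
    using rel(2,3) by (simp_all add: h_def)
  have "l *s (v \<bullet> v) = l *s (S *s a + T *s u)"
    unfolding rel(4) using l0 by (simp add: S_def T_def scale_right_distrib)
  then have vv: "v \<bullet> v = S *s a + T *s u"
    using l0 by simp
  have uu: "u \<bullet> u = (p - p * p - S) *s a + (1 - T) *s u"
    unfolding rel(5) vv by (simp add: algebra_simps)
  define P Q R where "P = p - p * q" and "Q = - q" and "R = l - q"
  have "p *s a + l *s v = q *s b + m *s w"
    using right_mult[OF a, of b] left_mult[OF b, of a] by (auto simp: d ca)
  then have mw: "m *s w = P *s a + Q *s u + R *s v"
    unfolding b_eq P_def Q_def R_def by (simp add: algebra_simps)
  have "(a - w) \<bullet> w + w \<bullet> (a - w) = w"
    unfolding d(3) by (rule idempotent_odd[OF b av(1)])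
  then have "2 *s (a \<bullet> w) - 2 *s (w \<bullet> w) = w"
    using axis_commutes[OF a ca, of w] by (simp add: scale_two mult_distribs algebra_simps)
  \<comment> \<open>Scaling by \<open>m * m\<close> leaves only \<open>m *s w\<close>, whose
    coordinates \<open>P\<close>, \<open>Q\<close>, \<open>R\<close> involve no division by
    \<open>m\<close>.\<close>
  from arg_cong[OF this, of "\<lambda>x. (m * m) *s x"]
  have idem: "2 *s (m *s (a \<bullet> (m *s w))) - 2 *s ((m *s w) \<bullet> (m *s w)) = m *s (m *s w)"
    by (simp add: mult_distribs scale_right_diff_distrib mult_ac)
  define ka ku kv where "ka = P * P + Q * Q * (p - p * p - S) + R * R * S"
    and "ku = Q * Q * (1 - T) + R * R * T" and "kv = P * R * l + Q * R * h"
  have "(m *s w) \<bullet> (m *s w) = ka *s a + ku *s u + (kv *s v + kv *s v)"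
    unfolding mw ka_def ku_def kv_def by (simp add: mult_distribs av uv uu vv algebra_simps)
  then have ww: "(m *s w) \<bullet> (m *s w) = ka *s a + ku *s u + (2 * kv) *s v"
    by (simp only: scale_two scale_scale[symmetric])
  have aw: "a \<bullet> (m *s w) = P *s a + (l * R) *s v"
    unfolding mw by (simp add: mult_distribs av mult.commute)
  have "(2 * m * P) *s a + 0 + (2 * m * l * R) *s v =
      (2 * ka + m * P) *s a + (2 * ku + m * Q) *s u + (4 * kv + m * R) *s v"
    using idem unfolding aw ww unfolding mw by (simp add: algebra_simps)
  from decomposition_unique[OF axisD(1-3)[OF a] _ eigenspace_scale[OF v] zero_space_scale[OF u] eigenspace_scale[OF v] this]
  have "(2 * ku + m * Q) *s u = 0" "(2 * m * l * R) *s v = (4 * kv + m * R) *s v"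
    by simp_all
  then have U: "2 * (Q * Q * (1 - T) + R * R * T) + m * Q = 0"
    and V: "2 * m * l * R = 4 * (P * R * l + Q * R * h) + m * R"
    using u0 v0 unfolding ku_def kv_def by (simp_all add: d)
  have rel1: "l * (1 - 2 * m + 2 * p) = 2 * q * (1 - m)" by (rule rel(1))
  \<comment> \<open>The comparison \<open>V\<close> of \<open>v\<close> coordinates has the common
    factor \<open>R\<close>; cancelling it and using \<open>rel1\<close> gives the claim. For
    \<open>R = 0\<close> it is void, and the \<open>u\<close> coordinates in \<open>U\<close> give
    \<open>2 * l = 1\<close> instead.\<close>
  have "l * (1 - 2 * p) = m * (1 - 2 * q)"
  proof (cases "R = 0")
    case False
    have "R * (2 * m * l - 4 * P * l - 4 * Q * h - m) = 0"
      using V by (simp add: algebra_simps)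
    then have "2 * m * l - 4 * (p - p * q) * l - 4 * (- q) * h - m = 0"
      using False unfolding P_def Q_def by simp
    moreover have "4 * (- q) * h = - (2 * q) * (1 - 2 * p * l)"
      by (simp add: h_def)
    ultimately have "2 * m * l - 4 * p * l + 2 * q - m = 0"
      by (simp add: algebra_simps)
    then show ?thesis
      using rel1 by algebra
  next
    case True
    then have q: "q = l" by (simp add: R_def)
    then have T: "T = 1 - m" using l0 by (simp add: T_def)
    have "l * (m * (1 - 2 * l)) = 0"
      using U unfolding Q_def q True T by (simp add: algebra_simps)
    then have l: "2 * l = 1" using l0 m0 by simp
    have "l * (1 - 2 * m + 2 * p) = l * (2 * (1 - m))"
      using rel1 q by simp
    then have "2 * p = 1"
      using l0 by simp
    then show ?thesis
      using l q by simp
  qed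
  then show ?thesis by (simp add: d)
qed

text \<open>With \<open>u = 0\<close> the formula for \<open>u \<bullet> v\<close> forces
  \<open>2 * p * l = 1\<close>, and the two expressions for \<open>v \<bullet> v\<close> then
  determine \<open>lt b\<close>. The last conclusion makes the lemma applicable with
  \<open>a\<close> and \<open>b\<close> exchanged.\<close>

lemma commutative_pair_two_dim:
  assumes a: "primitive_axis a" and b: "primitive_axis b"
    and ca: "lt a = rt a" and cb: "lt b = rt b" and nz: "odd_comp a b \<noteq> 0" and u0: "zero_comp a b = 0"
  shows "2 * phi a b * lt a = 1" "2 * lt a * lt b = 1 - lt a" "zero_comp b a = 0"
proof -
  define v w p q l m where
    "v = odd_comp a b" and "w = odd_comp b a" and "p = phi a b" and "q = phi b a"
    and "l = lt a" and "m = lt b"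
  note d = this
  have b_eq: "b = p *s a + v"
    unfolding d using decomposition(1)[OF a, of b] u0 by simp
  have v0: "v \<noteq> 0" and l0: "l \<noteq> 0" and l1: "l \<noteq> 1" and m0: "m \<noteq> 0"
    using nz axisD(3)[OF a] axisD(3)[OF b] by (auto simp: d)
  note rel = commutative_pair_products[OF a b ca cb nz, folded d, unfolded u0]
  have rel1: "l * (1 - 2 * m + 2 * p) = 2 * q * (1 - m)" by (rule rel(1))
  have pl: "2 * p * l = 1"
    using rel(3) v0 by simp
  then have p0: "p \<noteq> 0" by auto
  have "v \<bullet> v = (p - p * p) *s a"
    using rel(5) by simp
  then have "(l * (p - p * p)) *s a = (p * (m + q * (1 - m) - p)) *s a"
    using rel(4) by simp
  then have "l * (p - p * p) = p * (m + q * (1 - m) - p)"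
    using axisD(2)[OF a] by (metis scale_cancel_right)
  then have "p * (l * (1 - p)) = p * (m + q * (1 - m) - p)"
    by algebra
  then have f2: "l * (1 - p) = m + q * (1 - m) - p"
    using p0 by simp
  have "(1 - l) * (2 * l * m - (1 - l)) = 0"
    using f2 pl rel1 by algebra
  then have lm: "2 * l * m = 1 - l"
    using l1 by simp
  \<comment> \<open>The quantities in \<open>c\<close> and \<open>c'\<close> are the coordinates of
    \<open>m *s zero_comp b a\<close> along \<open>v\<close> and \<open>a\<close>.\<close>
  have "2 * (q * (1 - m) - l) = 0"
    using lm rel1 pl by algebra
  then have c: "q * (1 - m) - l = 0"
    by simp
  then have "2 * (l * (m - p + q * p * (1 - m))) = 0"
    using lm pl by algebra
  then have c': "m - p + q * p * (1 - m) = 0"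
    using l0 by (metis mult_eq_0_iff two_nonzero)
  have "p *s a + l *s v = q *s b + m *s w"
    using right_mult[OF a, of b] left_mult[OF b, of a] by (auto simp: d ca)
  then have mw: "m *s w = p *s a + l *s v - q *s b"
    by simp
  have "m *s zero_comp b a = m *s a - (m * q) *s b - m *s w"
    by (simp add: zero_comp_def d algebra_simps)
  also have "\<dots> = (m - p + q * p * (1 - m)) *s a + (q * (1 - m) - l) *s v"
    unfolding mw b_eq by (simp add: algebra_simps)
  finally have "m *s zero_comp b a = 0"
    using c c' by simp
  then show "zero_comp b a = 0"
    using m0 by simp
  show "2 * phi a b * lt a = 1" "2 * lt a * lt b = 1 - lt a"
    by (fact pl[unfolded d] lm[unfolded d])+
qed

lemma commutative_pair:
  assumes a: "primitive_axis a" and b: "primitive_axis b" and ca: "lt a = rt a" and cb: "lt b = rt b"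
    and nza: "odd_comp a b \<noteq> 0" and nzb: "odd_comp b a \<noteq> 0"
  shows "lt a = lt b \<and> phi a b = phi b a \<or>
    lt a + lt b = 1 \<and> 2 * phi a b = 1 + lt b \<and> 2 * phi b a = 1 + lt a"
proof -
  define p q l m where "p = phi a b" and "q = phi b a" and "l = lt a" and "m = lt b"
  note d = this
  have e1: "l * (1 - 2 * m + 2 * p) = 2 * q * (1 - m)" and e2: "m * (1 - 2 * l + 2 * q) = 2 * p * (1 - l)"
    unfolding d by (rule commutative_pair_products(1)[OF a b ca cb nza] commutative_pair_products(1)[OF b a cb ca nzb])+
  have l0: "l \<noteq> 0" and m0: "m \<noteq> 0"
    using axisD(3)[OF a] axisD(3)[OF b] by (auto simp: d)
  have "l = m \<and> p = q \<or> l + m = 1 \<and> 2 * p = 1 + m \<and> 2 * q = 1 + l"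
  proof (cases "zero_comp a b = 0")
    case True
    note ab = commutative_pair_two_dim[OF a b ca cb nza True, folded d]
    note ba = commutative_pair_two_dim[OF b a cb ca nzb ab(3), folded d]
    have lm: "l = m"
      using ab(2) ba(2) by (simp add: mult.commute mult.left_commute)
    then have "2 * (l * (p - q)) = 0"
      using ab(1) ba(1) by (simp add: algebra_simps)
    then show ?thesis
      using l0 lm by simp
  next
    case False
    have e3: "l * (1 - 2 * p) = m * (1 - 2 * q)"
      using commutative_pair_three_dim[OF a b ca cb nza False] by (simp add: d)
    \<comment> \<open>The equations \<open>e1\<close> and \<open>e2\<close> are linear in
      \<open>p\<close> and \<open>q\<close>, with determinant a multiple of
      \<open>1 - l - m\<close>. If it is nonzero, the solution is \<open>2 * p = m\<close>,
      \<open>2 * q = l\<close>, and \<open>e3\<close> forces \<open>l = m\<close>. If it is zero,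
      they reduce to one equation, and \<open>e3\<close> factors as
      \<open>(1 - 2 * m) * (2 * p - (1 + m)) = 0\<close>.\<close>
    show ?thesis
    proof (cases "1 - l - m = 0")
      case False
      have "(1 - l - m) * (2 * p - m) = 0" "(1 - l - m) * (2 * q - l) = 0"
        using e1 e2 by algebra+
      then have pq: "2 * p = m" "2 * q = l"
        using False by auto
      then have "l * (1 - m) = m * (1 - l)"
        using e3 by simp
      then have "l = m"
        by (simp add: algebra_simps)
      then show ?thesis
        using pq by (metis mult_cancel_left two_nonzero)
    next
      case True
      then have m: "l = 1 - m" by (simp add: algebra_simps)
      have "l * (1 - 2 * m + 2 * p - 2 * q) = 0"
        using e1 m by algebra
      then have q: "2 * q = 1 - 2 * m + 2 * p"
        using l0 by simp
      have "(1 - 2 * m) * (2 * p - (1 + m)) = 0"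
        using e3 q m by algebra
      then consider "2 * m = 1" | "2 * p = 1 + m" by auto
      then show ?thesis
      proof cases
        case 1
        then have "2 * l = 2 * m" "2 * q = 2 * p"
          using m q by algebra+
        then show ?thesis by simp
      next
        case 2
        then have "2 * q = 1 + l" "l + m = 1"
          using m q by algebra+
        then show ?thesis using 2 by simp
      qed
    qed
  qed
  then show ?thesis by (simp add: d)
qed

lemma axis_pair_cases:
  assumes a: "primitive_axis a" and b: "primitive_axis b"
  obtains (eq) "a = b"
    | (orthogonal) "a \<in> zero_space b" "b \<in> zero_space a"
    | (noncommutative) "lt a \<noteq> rt a" "lt b \<noteq> rt b" "phi a b = phi b a"
    | (same_type) "lt a = rt a" "lt b = rt b" "lt a = lt b" "phi a b = phi b a"
    | (complementary) "lt a = rt a" "lt b = rt b" "lt a + lt b = 1" "2 * phi a b = 1 + lt b" "2 * phi b a = 1 + lt a"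
proof (cases "odd_comp a b = 0 \<or> odd_comp b a = 0")
  case True
  then show ?thesis
    using no_odd_component[OF a b] no_odd_component[OF b a] that by blast
next
  case False
  then show ?thesis
    using noncommutative_pair[OF a b] noncommutative_pair[OF b a] commutative_pair[OF a b] that by blast
qed

section \<open>Reflections acting on axes, types and coefficients\<close>

lemma tau_zero_space: "primitive_axis a \<Longrightarrow> x \<in> zero_space a \<Longrightarrow> tau a x = x"
  by (simp add: tau_even decomposition_zero_space(3))

lemma phi_zero_space: "primitive_axis a \<Longrightarrow> x \<in> zero_space a \<Longrightarrow> phi a x = 0"
  by (rule decomposition_zero_space)

lemma tau_zero: "primitive_axis a \<Longrightarrow> tau a 0 = 0"
  by (rule tau_zero_space) simp_all

lemma tau_zero_space_image:
  "primitive_axis c \<Longrightarrow> x \<in> zero_space y \<Longrightarrow> tau c x \<in> zero_space (tau c y)"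
  by (simp add: zero_space_def tau_zero flip: tau_mult)

lemma tau_eigenspace_image:
  "primitive_axis c \<Longrightarrow> x \<in> eigenspace y l d \<Longrightarrow> tau c x \<in> eigenspace (tau c y) l d"
  by (simp add: eigenspace_def tau_linear flip: tau_mult)

text \<open>If \<open>c\<close> has an odd component with respect to \<open>y\<close>, its image
  under \<open>tau c\<close> is a nonzero odd vector of \<open>tau c y\<close> and determines the
  type there. Otherwise \<open>tau c\<close> fixes \<open>y\<close>, so even an arbitrarily chosen
  type is preserved.\<close>

lemma ty_tau:
  assumes c: "primitive_axis c" and y: "primitive_axis y"
  shows "ty (tau c y) = ty y"
proof (cases "odd_comp y c = 0")
  case True
  then have "tau c y = y"
    using no_odd_component[OF y c] tau_zero_space[OF c] decomposition_self(3)[OF c] tau_even[OF c] by metis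
  then show ?thesis by simp
next
  case False
  have "tau c (odd_comp y c) \<noteq> 0"
    using False tau_involution[OF c] tau_zero[OF c] by metis
  from eigenspace_type_unique[OF axis_type[OF tau_axis[OF c y]] tau_eigenspace_image[OF c decomposition(3)[OF y]] this
      axisD(3)[OF y]]
  show ?thesis
    by (simp add: prod_eq_iff)
qed

lemma phi_tau_tau:
  assumes c: "primitive_axis c" and y: "primitive_axis y"
  shows "phi (tau c y) (tau c z) = phi y z"
proof -
  have "tau c (zero_comp y z) \<in> zero_space (tau c y)" "tau c (odd_comp y z) \<in> odd_part (tau c y)"
    unfolding ty_tau[OF c y] by (intro tau_zero_space_image tau_eigenspace_image decomposition c y)+
  moreover have "tau c z = phi y z *s tau c y + tau c (zero_comp y z) + tau c (odd_comp y z)"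
    by (subst decomposition(1)[OF y, of z]) (simp only: tau_linear[OF c])
  ultimately show ?thesis
    by (rule decomposition_eqs(1)[OF tau_axis[OF c y]])
qed

section \<open>Exceptional axes and the weighted symmetry of coefficients\<close>

text \<open>In characteristic 3 the types \<open>-1\<close> and \<open>2\<close> coincide and no axis is exceptional.\<close>

definition exceptional :: "'a \<Rightarrow> bool" where
  "exceptional a \<longleftrightarrow> ty a = (- 1, - 1) \<and> (\<exists>b. primitive_axis b \<and> ty b = (2, 2) \<and> phi a b \<noteq> phi b a)"

lemma exceptional_tau:
  assumes c: "primitive_axis c" and y: "primitive_axis y" and "exceptional y"
  shows "exceptional (tau c y)"
proof -
  obtain b where b: "primitive_axis b" "ty b = (2, 2)" "phi y b \<noteq> phi b y" and y': "ty y = (- 1, - 1)"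
    using assms(3) unfolding exceptional_def by blast
  have "primitive_axis (tau c b)" "ty (tau c b) = (2, 2)" "phi (tau c y) (tau c b) \<noteq> phi (tau c b) (tau c y)"
    using b by (simp_all add: tau_axis c ty_tau phi_tau_tau y)
  then show ?thesis
    unfolding exceptional_def ty_tau[OF c y] using y' by blast
qed

text \<open>Unequal coefficients leave only the complementary case of
  \<open>axis_pair_cases\<close>. In characteristic 3 its two values would both be zero, hence
  equal.\<close>

lemma exceptional_partner:
  assumes "primitive_axis a" "exceptional a"
  obtains b where "primitive_axis b" "ty b = (2, 2)" "2 * phi a b = 3" "phi b a = 0" "(3::'f) \<noteq> 0"
proof -
  obtain b where b: "primitive_axis b" "ty b = (2, 2)" "phi a b \<noteq> phi b a" and a: "ty a = (- 1, - 1)"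
    using assms(2) unfolding exceptional_def by blast
  from assms(1) b(1) have "2 * phi a b = 1 + lt b \<and> 2 * phi b a = 1 + lt a"
  proof (cases rule: axis_pair_cases)
    case orthogonal
    then show ?thesis using b phi_zero_space assms(1) by metis
  qed (use b in auto)
  then have ab: "2 * phi a b = 3" and ba: "phi b a = 0"
    using a b(2) by auto
  then have "(3::'f) \<noteq> 0"
    using b(3) by auto
  with ab ba b that show ?thesis by blast
qed

text \<open>Take a partner \<open>b\<close> of \<open>d\<close> and evaluate
  \<open>phi c (d \<bullet> b)\<close> twice. Along \<open>d\<close> it is
  \<open>phi d b * phi c d\<close>, as \<open>c\<close> is orthogonal to \<open>b\<close> and
  \<open>tau d b\<close>, both of type 2. Along \<open>b\<close> it is zero, as \<open>tau b\<close>
  fixes \<open>c\<close>. Finally \<open>phi d b\<close> is 3/2.\<close>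

lemma exceptional_orthogonal:
  assumes c: "primitive_axis c" "ty c = (- 1, - 1)" "\<not> exceptional c"
    and d: "primitive_axis d" "exceptional d"
  shows "phi c d = 0"
proof -
  obtain b where b: "primitive_axis b" "ty b = (2, 2)" "2 * phi d b = 3" "phi b d = 0" and 3: "(3::'f) \<noteq> 0"
    using exceptional_partner[OF d] by blast
  \<comment> \<open>Outside characteristic 3 the types differ, and the complementary case would give
    the coefficients 3/2 and 0, against \<open>same\<close>.\<close>
  have orth: "c \<in> zero_space b' \<and> b' \<in> zero_space c" if b': "primitive_axis b'" "ty b' = (2, 2)" for b'
  proof -
    have same: "phi c b' = phi b' c"
      using c b' unfolding exceptional_def by blast
    have ne: "(- 1::'f) \<noteq> 2"
      using 3 by (metis add.commute one_add_one numeral_Bit1 numeral_One add.assoc add.right_inverse numeral_3_eq_3)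
    from c(1) b'(1) show ?thesis
      by (cases rule: axis_pair_cases) (use c(2) b'(2) same ne 3 in auto)
  qed
  have td: "primitive_axis (tau d b)" "ty (tau d b) = (2, 2)"
    using b by (simp_all add: tau_axis ty_tau d)
  note lin = decomposition_linear[OF c(1)]
  have "phi c (d \<bullet> b) = phi d b * phi c d"
    using phi_zero_space[OF c(1)] orth[OF b(1,2)] orth[OF td]
    by (simp add: left_mult[OF d(1)] odd_tau[OF d(1)] lin)
  moreover have "phi c (tau b d) = phi c d"
    using phi_tau_tau[OF b(1) c(1), of d] tau_zero_space[OF b(1)] orth[OF b(1,2)] by simp
  then have "phi c (d \<bullet> b) = 0"
    by (simp add: right_mult[OF b(1)] odd_tau[OF b(1)] lin b)
  moreover have "phi d b \<noteq> 0"
    using b(3) 3 by auto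
  ultimately show ?thesis by simp
qed

text \<open>Any fixed nonzero value would do on the nonexceptional axes of type \<open>-1\<close>: in characteristic other
  than 3 they are orthogonal to the axes of type \<open>2\<close> and to the exceptional ones.\<close>

definition weight :: "'a \<Rightarrow> 'f" where
  "weight a = (if lt a \<noteq> rt a \<or> ty a = (- 1, - 1) \<and> \<not> exceptional a then 1 else 1 + lt a)"

lemma weight_eq_0: "primitive_axis a \<Longrightarrow> weight a = 0 \<Longrightarrow> exceptional a"
  by (auto simp: weight_def prod_eq_iff add_eq_0_iff split: if_splits)

lemma weight_tau:
  assumes c: "primitive_axis c" and y: "primitive_axis y"
  shows "weight (tau c y) = weight y"
proof -
  have "exceptional (tau c y) \<longleftrightarrow> exceptional y"
    using exceptional_tau[OF c y] exceptional_tau[OF c tau_axis[OF c y]] tau_involution[OF c] by metis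
  then show ?thesis
    by (simp add: weight_def ty_tau[OF c y])
qed

text \<open>Both sides vanish: \<open>phi b a = 0\<close>, and either \<open>3 = 0\<close>, so that
  \<open>phi a b = 0\<close>, or \<open>a\<close> is exceptional and has weight 0.\<close>

lemma weight_phi_minus_one:
  assumes "primitive_axis a" "primitive_axis b" "lt a = rt a" "lt b = rt b" "lt a = - 1"
    "lt a + lt b = 1" "2 * phi a b = 1 + lt b" "2 * phi b a = 1 + lt a"
  shows "weight a * phi a b = weight b * phi b a"
proof -
  have "lt b = 2"
    using assms(5,6) by algebra
  have ba: "phi b a = 0" and ab: "2 * phi a b = 3"
    using assms \<open>lt b = 2\<close> by auto
  show ?thesis
  proof (cases "(3::'f) = 0")
    case True
    then show ?thesis using ab ba by simp
  next
    case False
    then have "phi a b \<noteq> phi b a" using ab ba by auto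
    then have "exceptional a"
      unfolding exceptional_def using assms \<open>lt b = 2\<close> by (metis prod.collapse)
    then show ?thesis
      using assms ba by (simp add: weight_def)
  qed
qed

text \<open>Away from type -1, the complementary case explains the weight: both sides become
  \<open>(1 + lt a) * (1 + lt b) / 2\<close>. Axes of equal type have equal weights unless exactly
  one is exceptional, and then the coefficients vanish.\<close>

lemma weight_phi_commute:
  assumes a: "primitive_axis a" and b: "primitive_axis b"
  shows "weight a * phi a b = weight b * phi b a"
  using a b
proof (cases rule: axis_pair_cases)
  case orthogonal
  then show ?thesis using a b by (simp add: phi_zero_space)
next
  case same_type
  then have ty: "ty a = ty b" by (simp add: prod_eq_iff)
  show ?thesis
  proof (cases "ty a = (- 1, - 1) \<and> exceptional a \<noteq> exceptional b")
    case True
    then have "phi a b = 0"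
      using exceptional_orthogonal[OF a _ _ b] exceptional_orthogonal[OF b _ _ a] ty same_type by metis
    then show ?thesis using same_type by simp
  next
    case False
    then have "weight a = weight b"
      using ty by (auto simp: weight_def)
    then show ?thesis using same_type by simp
  qed
next
  case complementary
  show ?thesis
  proof (cases "lt a = - 1 \<or> lt b = - 1")
    case True
    then show ?thesis
      using weight_phi_minus_one[OF a b] weight_phi_minus_one[OF b a] complementary by (metis add.commute)
  next
    case False
    then have "weight a = 1 + lt a" "weight b = 1 + lt b"
      using complementary(1,2) by (auto simp: weight_def)
    then have "weight a * (2 * phi a b) = weight b * (2 * phi b a)"
      unfolding complementary(4,5) by simp
    then show ?thesis by simp
  qed
qed (simp_all add: weight_def)

section \<open>Self-adjointness of multiplication by axes and closure of the zero space\<close>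

lemma axes_mult_in_span:
  assumes c: "primitive_axis c" and y: "primitive_axis y"
  shows "y \<bullet> c \<in> span (Collect primitive_axis)"
  unfolding right_mult[OF c] odd_tau[OF c]
  by (intro span_add span_scale span_diff span_base) (simp_all add: c y tau_axis)

lemma span_axes:
  assumes "PAJ_generated_by X"
  shows "span (Collect primitive_axis) = UNIV"
proof -
  let ?S = "span (Collect primitive_axis)"
  have X: "X \<subseteq> ?S" and gen: "generated_subalgebra X = UNIV"
    using assms span_base unfolding PAJ_generated_by_def by auto
  have axis: "y \<bullet> c \<in> ?S" if "y \<in> ?S" "primitive_axis c" for y c
    using that(1)
  proof (induction rule: span_induct)
    case base
    show ?case
      by (rule subspaceI) (simp_all add: mult_distribs span_zero span_add span_scale)
  next
    case (step y)
    then show ?case using axes_mult_in_span that(2) by simp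
  qed
  have "y \<bullet> z \<in> ?S" if "y \<in> ?S" "z \<in> ?S" for y z
    using that(2)
  proof (induction rule: span_induct)
    case base
    show ?case
      by (rule subspaceI) (simp_all add: mult_distribs span_zero span_add span_scale)
  next
    case (step z)
    then show ?case using axis that(1) by simp
  qed
  then have "generated_subalgebra X \<subseteq> ?S"
    unfolding generated_subalgebra_def using X subspace_span by (intro hull_minimal) auto
  then show ?thesis using gen by auto
qed

text \<open>Both sides are linear in \<open>y\<close>; for an axis \<open>y\<close> both equal \<open>weight y * phi y (a \<bullet> c)\<close>.\<close>

lemma weighted_phi_mult:
  assumes a: "primitive_axis a" and c: "primitive_axis c" and span: "y \<in> span (Collect primitive_axis)"
  shows "weight a * phi a (y \<bullet> c) =
    phi a c * (weight a * phi a y) + lt a / 2 * (weight c * (phi c y - phi c (tau a y)))"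
  using span
proof (induction rule: span_induct)
  case base
  note lin = decomposition_linear[OF a] decomposition_linear[OF c] tau_linear[OF a]
    decomposition_zero_space[OF a] decomposition_zero_space[OF c] tau_zero[OF a]
  show ?case
  proof (rule subspaceI, goal_cases)
    case (3 k x)
    have "weight a * phi a ((k *s x) \<bullet> c) = k * (weight a * phi a (x \<bullet> c))"
      by (simp add: lin mult_distribs)
    also have "\<dots> = k * (phi a c * (weight a * phi a x) + lt a / 2 * (weight c * (phi c x - phi c (tau a x))))"
      using 3 by simp
    finally show ?case
      by (simp add: lin algebra_simps)
  qed (simp_all add: lin mult_distribs algebra_simps add_divide_distrib)
next
  case (step y)
  then have y: "primitive_axis y" by simp
  have sym: "weight a * phi a c = weight c * phi c a" "weight a * phi a y = weight y * phi y a"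
    "weight c * phi c y = weight y * phi y c"
    using a c y weight_phi_commute by auto
  \<comment> \<open>Symmetry is applied to \<open>a\<close> and \<open>tau c y\<close>; applying
    \<open>tau c\<close> to both arguments then moves the reflection from \<open>y\<close> to
    \<open>a\<close>.\<close>
  have tc: "weight a * phi a (tau c y) = weight y * phi y (tau c a)"
    using weight_phi_commute[OF a tau_axis[OF c y]] phi_tau_tau[OF c y, of "tau c a"]
    by (simp add: c y weight_tau)
  have ta: "weight c * phi c (tau a y) = weight y * phi y (tau a c)"
    using weight_phi_commute[OF y tau_axis[OF a c]] phi_tau_tau[OF a c, of "tau a y"]
    by (simp add: a c weight_tau)
  note lin = decomposition_linear[OF a] decomposition_linear[OF y]
  \<comment> \<open>The product \<open>y \<bullet> c\<close> is expanded along \<open>c\<close>, the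
    result is recognised by symmetry as the expansion of \<open>a \<bullet> c\<close> along
    \<open>c\<close>, and that product is expanded again along \<open>a\<close>.\<close>
  have "weight a * phi a (y \<bullet> c) =
      phi c y * (weight a * phi a c) + rt c / 2 * (weight a * phi a y - weight a * phi a (tau c y))"
    by (simp add: right_mult[OF c] odd_tau[OF c] lin algebra_simps)
  also have "\<dots> = (weight c * phi c y) * phi c a + rt c / 2 * (weight y * phi y a - weight y * phi y (tau c a))"
    unfolding tc sym(1,2) by (simp add: algebra_simps)
  also have "\<dots> = weight y * phi y (a \<bullet> c)"
    unfolding sym(3) by (simp add: right_mult[OF c] odd_tau[OF c] lin algebra_simps)
  also have "\<dots> = phi a c * (weight y * phi y a) + lt a / 2 * (weight y * phi y c - weight y * phi y (tau a c))"
    by (simp add: left_mult[OF a] odd_tau[OF a] lin algebra_simps)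
  finally show ?case
    by (simp only: sym ta right_diff_distrib)
qed

text \<open>For \<open>y\<close> in the zero space, \<open>phi a y = 0\<close> and
  \<open>tau a y = y\<close>, so the right side of \<open>weighted_phi_mult\<close> vanishes for
  every axis \<open>c\<close>. As axes span, \<open>phi a (y \<bullet> z) = 0\<close>; the grading
  removes the odd component.\<close>

lemma zero_space_mult_closed:
  assumes PAJ: "PAJ_generated_by X" and a: "primitive_axis a" and "\<not> exceptional a"
    and y: "y \<in> zero_space a" and z: "z \<in> zero_space a"
  shows "y \<bullet> z \<in> zero_space a"
proof -
  note lin = decomposition_linear[OF a] decomposition_zero_space[OF a]
  have w: "weight a \<noteq> 0"
    using assms weight_eq_0 by blast
  have axis: "phi a (y \<bullet> c) = 0" if "primitive_axis c" for c
    using weighted_phi_mult[OF a that, of y] w y tau_zero_space[OF a y] by (simp add: span_axes[OF PAJ] phi_zero_space a)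
  have "z \<in> span (Collect primitive_axis)"
    by (simp add: span_axes[OF PAJ])
  then have phi: "phi a (y \<bullet> z) = 0"
  proof (induction rule: span_induct)
    case base
    show ?case
      by (rule subspaceI) (simp_all add: mult_distribs lin)
  qed (simp add: axis)
  have "y \<in> even_part a" "z \<in> even_part a"
    using y z by (simp_all add: even_part_iff_odd[OF a] lin)
  then have "odd_comp a (y \<bullet> z) = 0"
    using axisD(6)[OF a] even_part_iff_odd[OF a] by blast
  then have "y \<bullet> z = zero_comp a (y \<bullet> z)"
    using decomposition(1)[OF a, of "y \<bullet> z"] phi by simp
  then show ?thesis
    using decomposition(2)[OF a] by metis
qed

section \<open>Frobenius forms and the radical\<close>

text \<open>Associativity and \<open>b \<bullet> b = b\<close> give
  \<open>B b (b \<bullet> x) = B b x\<close>. For odd \<open>x\<close> the left side is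
  \<open>lt b * B b x\<close> with \<open>lt b\<close> different from 1, so \<open>b\<close> is
  orthogonal to its odd part. The form need not be symmetric, so the other side is treated
  likewise.\<close>

lemma frobenius_axis:
  assumes B: "frobenius_form B" and b: "primitive_axis b"
  shows "B b u = phi b u * B b b" "B u b = phi b u * B b b"
proof -
  have assoc: "B x (y \<bullet> z) = B (x \<bullet> y) z" for x y z
    using B by (simp add: frobenius_form_def)
  have "module_hom (*s) (*) (\<lambda>y. B x y)" "module_hom (*s) (*) (\<lambda>x. B x y)" for x y
    using B unfolding frobenius_form_def Vector_Spaces.linear_def by blast+
  note lin = this[THEN module_hom.add] this[THEN module_hom.scale] this[THEN module_hom.zero]
  have idem: "B b (b \<bullet> x) = B b x" "B (x \<bullet> b) b = B x b" for x
    using assoc axisD(1)[OF b] by metis+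
  have "B b (b \<bullet> odd_comp b u) = lt b * B b (odd_comp b u)" "B (odd_comp b u \<bullet> b) b = rt b * B (odd_comp b u) b"
    by (simp_all add: eigenspaceD[OF decomposition(3)[OF b]] lin)
  then have "B b (odd_comp b u) = 0" "B (odd_comp b u) b = 0"
    using idem axisD(3,4)[OF b] by auto
  then show "B b u = phi b u * B b b" "B u b = phi b u * B b b"
    using idem[of u] by (simp_all add: left_mult[OF b] right_mult[OF b] lin)
qed

lemma exceptional_in_radical:
  assumes a: "primitive_axis a" "exceptional a" and B: "frobenius_form B"
  shows "a \<in> form_radical B"
proof -
  obtain b where b: "primitive_axis b" "2 * phi a b = 3" "phi b a = 0" "(3::'f) \<noteq> 0"
    using exceptional_partner[OF a] by blast
  have "phi a b * B a a = B a b"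
    by (rule frobenius_axis(1)[OF B a(1), symmetric])
  also have "\<dots> = 0"
    using frobenius_axis(2)[OF B b(1), of a] b(3) by simp
  finally have "B a a = 0"
    using b(2,4) by auto
  then have "B a u = 0" for u
    using frobenius_axis(1)[OF B a(1), of u] by simp
  then show ?thesis
    by (simp add: form_radical_def)
qed

end

theorem theoremG:
  fixes scale :: "'f::field \<Rightarrow> 'a::ab_group_add \<Rightarrow> 'a"
    and mult :: "'a \<Rightarrow> 'a \<Rightarrow> 'a"
    and ty :: "'a \<Rightarrow> 'f \<times> 'f"
    and X :: "'a set" and a :: 'a
  assumes "CHAR('f) \<noteq> 2"
    and "nonassoc_algebra scale mult"
    and "nonassoc_algebra.type_assignment scale mult ty"
    and "nonassoc_algebra.PAJ_generated_by scale mult X"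
    and "a \<in> X"
  shows "{mult y z |y z. y \<in> nonassoc_algebra.zero_space mult a \<and> z \<in> nonassoc_algebra.zero_space mult a}
           \<subseteq> nonassoc_algebra.zero_space mult a
       \<or> (ty a = (-1, -1) \<and>
          (\<exists>b. nonassoc_algebra.primitive_axis scale mult b \<and> ty b = (2, 2) \<and> mult a b \<noteq> 0) \<and>
          (\<forall>B. nonassoc_algebra.frobenius_form scale mult B \<longrightarrow> a \<in> nonassoc_algebra.form_radical B))"
proof -
  have "(2::'f) \<noteq> 0"
  proof
    assume "(2::'f) = 0"
    then have "CHAR('f) dvd 2"
      using of_nat_eq_0_iff_char_dvd[of 2, where 'a = 'f] by simp
    then have "CHAR('f) \<le> 2" "CHAR('f) \<noteq> 0"
      by (auto intro: dvd_imp_le intro!: gr0I)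
    moreover have "CHAR('f) \<noteq> 1"
      by simp
    ultimately show False
      using assms(1) by linarith
  qed
  interpret nonassoc_algebra scale mult by fact
  interpret typed_algebra scale mult ty
    by (intro typed_algebra.intro typed_algebra_axioms.intro assms(2,3) \<open>(2::'f) \<noteq> 0\<close>)
  have a: "primitive_axis a"
    using assms(4,5) by (auto simp: PAJ_generated_by_def)
  show ?thesis
  proof (cases "exceptional a")
    case False
    then show ?thesis
      using zero_space_mult_closed[OF assms(4) a] by (intro disjI1) blast
  next
    case True
    obtain b where b: "primitive_axis b" "ty b = (2, 2)" "2 * phi a b = 3" "(3::'f) \<noteq> 0"
      using exceptional_partner[OF a True] by blast
    \<comment> \<open>If the product is zero, the odd component of \<open>b\<close> vanishes, and
      \<open>left_mult\<close> leaves \<open>phi a b *s a = 0\<close>, contrary to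
      \<open>2 * phi a b = 3\<close>.\<close>
    have "phi a b = 0" if "mult a b = 0"
      using left_mult[OF a, of b] product_zero_odd[OF a that] axisD(2)[OF a] that by simp
    then have "mult a b \<noteq> 0"
      using b(3,4) by auto
    moreover have "ty a = (- 1, - 1)"
      using True by (simp add: exceptional_def)
    ultimately show ?thesis
      using b(1,2) exceptional_in_radical[OF a True] by (intro disjI2 conjI exI[of _ b] allI impI)
  qed
qed

end
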